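(* Let $K$ be a real quadratic field, $\mathcal{I}$ a nonzero ideal of $\mathcal{O}_K$, and $x\in\mathcal{I}$ with $N(x)^2\le N(\mathcal{I})^2\Delta_K/3$. Then the good bases of $\mathcal{I}$ of the form $\{x,y\}$ with $y\in\mathcal{I}$ fall into at most two equivalence classes; i.e. $x$ extends to at most two good bases of $\mathcal{I}$, up to equivalence.
   Context: $K=\mathbb{Q}(\sqrt D)\subset\mathbb{R}$, $D>1$ square-free; $\bar x$ the Galois conjugate, $N(x)=x\bar x$, $\Delta_K$ the discriminant, $N(\mathcal{I})=|\mathcal{O}_K/\mathcal{I}|$. $\psi(x)=(x,\bar x)\in\mathbb{R}^2$, $\Lambda_{\mathcal{I}}=\psi(\mathcal{I})$, $T_\alpha=\mathrm{diag}(\alpha,1/\alpha)$. A basis $\{u,v\}$ of a planar lattice is minimal if $\|u\|=\|v\|$ and $|\langle u,v\rangle|\le\frac12\|u\|\|v\|$. A $\mathbb{Z}$-basis $\{x,y\}$ of $\mathcal{I}$ is good (for twisting) if for some $\alpha>0$ the lattice $T_\alpha\Lambda_{\mathcal{I}}$ is well-rounded with minimal basis $\{T_\alpha\psi(x),T_\alpha\psi(y)\}$. Two bases $\{x,y\},\{x',y'\}$ of $\mathcal{I}$ are equivalent if $F(x,y)=F(x',y')$, where $F(x,y)=N(x)^2+N(x)N(y)+N(y)^2-N(\mathcal{I})^2\Delta_K/4$. *)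

theory Defs
  imports "HOL-Analysis.Analysis" "HOL-Computational_Algebra.Squarefree" "HOL-Algebra.QuotRing"
begin

definition quad_field :: "nat \<Rightarrow> real set" where
  "quad_field D = {a + b * sqrt (real D) | a b. a \<in> \<rat> \<and> b \<in> \<rat>}"

text \<open>Meaningful on the field only, where the rational coordinates of an element are
  unique as soon as D is not a square.\<close>

definition gal_conj :: "nat \<Rightarrow> real \<Rightarrow> real" where
  "gal_conj D x = (THE z. \<exists>a\<in>\<rat>. \<exists>b\<in>\<rat>. x = a + b * sqrt (real D) \<and> z = a - b * sqrt (real D))"

lemma sqrt_squarefree_irrational:
  assumes "1 < D" and "squarefree D"
  shows "sqrt (real D) \<notin> \<rat>"
proof
  assume "sqrt (real D) \<in> \<rat>"
  moreover have "algebraic_int (sqrt (real D))"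
    by (intro algebraic_int_sqrt) simp
  ultimately have "sqrt (real D) \<in> \<int>"
    by (metis rational_algebraic_int_is_int)
  then obtain i where "sqrt (real D) = of_int i" by (elim Ints_cases)
  then have "(of_int i)\<^sup>2 = real D" by (metis of_nat_0_le_iff real_sqrt_pow2)
  then have "of_int (i\<^sup>2) = (of_int (int D) :: real)" by simp
  then have "i\<^sup>2 = int D" by (simp only: of_int_eq_iff)
  then have D: "D = (nat \<bar>i\<bar>)\<^sup>2"
    by (metis nat_int nat_power_eq power2_abs abs_ge_zero)
  then have "(nat \<bar>i\<bar>)\<^sup>2 dvd D" by simp
  with assms(2) have "nat \<bar>i\<bar> dvd 1" by (rule squarefreeD)
  then have "nat \<bar>i\<bar> = 1" by simp
  with D assms(1) show False by simp
qed

lemma gal_conj_eq: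
  assumes "1 < D" "squarefree D" "a \<in> \<rat>" "b \<in> \<rat>"
  shows "gal_conj D (a + b * sqrt (real D)) = a - b * sqrt (real D)"
  unfolding gal_conj_def
proof (rule the_equality)
  show "\<exists>a'\<in>\<rat>. \<exists>b'\<in>\<rat>. a + b * sqrt (real D) = a' + b' * sqrt (real D) \<and>
    a - b * sqrt (real D) = a' - b' * sqrt (real D)"
    using assms by blast
next
  fix z
  assume "\<exists>a'\<in>\<rat>. \<exists>b'\<in>\<rat>. a + b * sqrt (real D) = a' + b' * sqrt (real D) \<and>
    z = a' - b' * sqrt (real D)"
  then obtain a' b' where ab: "a' \<in> \<rat>" "b' \<in> \<rat>"
    "a + b * sqrt (real D) = a' + b' * sqrt (real D)" "z = a' - b' * sqrt (real D)"
    by blast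
  have "b' = b"
  proof (rule ccontr)
    assume ne: "b' \<noteq> b"
    then have "sqrt (real D) = (a - a') / (b' - b)"
      using ab(3) by (simp add: eq_divide_eq algebra_simps)
    also have "\<dots> \<in> \<rat>" using assms ab by (intro Rats_divide Rats_diff)
    finally show False using sqrt_squarefree_irrational assms by blast
  qed
  with ab show "z = a - b * sqrt (real D)" by simp
qed

definition field_norm :: "nat \<Rightarrow> real \<Rightarrow> real" where
  "field_norm D x = x * gal_conj D x"

definition alg_int_ring :: "nat \<Rightarrow> real ring" where
  "alg_int_ring D = \<lparr>carrier = {x \<in> quad_field D. algebraic_int x},
     mult = (*), one = 1, zero = 0, add = (+)\<rparr>"

definition ideal_norm :: "nat \<Rightarrow> real set \<Rightarrow> nat" where
  "ideal_norm D I = card (carrier (alg_int_ring D Quot I))"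

definition Z_basis :: "'a::real_vector set \<Rightarrow> 'a \<Rightarrow> 'a \<Rightarrow> bool" where
  "Z_basis L u v \<longleftrightarrow>
     L = {of_int m *\<^sub>R u + of_int n *\<^sub>R v | m n. True} \<and>
     (\<forall>m n. of_int m *\<^sub>R u + of_int n *\<^sub>R v = 0 \<longrightarrow> m = 0 \<and> n = 0)"

text \<open>The square of the determinant of the matrix of conjugates of an integral basis;
  it does not depend on the basis.\<close>

definition field_discr :: "nat \<Rightarrow> real" where
  "field_discr D = (THE d. \<exists>u v. Z_basis (carrier (alg_int_ring D)) u v \<and>
     d = (u * gal_conj D v - v * gal_conj D u)\<^sup>2)"

definition canon_emb :: "nat \<Rightarrow> real \<Rightarrow> real \<times> real" where
  "canon_emb D x = (x, gal_conj D x)"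

definition twist :: "real \<Rightarrow> real \<times> real \<Rightarrow> real \<times> real" where
  "twist \<alpha> = (\<lambda>(a, b). (\<alpha> * a, 1 / \<alpha> * b))"

text \<open>The nonzero vectors of least length span the plane.\<close>

definition well_rounded :: "(real \<times> real) set \<Rightarrow> bool" where
  "well_rounded L \<longleftrightarrow>
     span {v \<in> L. v \<noteq> 0 \<and> (\<forall>w\<in>L. w \<noteq> 0 \<longrightarrow> norm v \<le> norm w)} = UNIV"

definition minimal_basis :: "(real \<times> real) set \<Rightarrow> real \<times> real \<Rightarrow> real \<times> real \<Rightarrow> bool" where
  "minimal_basis L u v \<longleftrightarrow>
     Z_basis L u v \<and> norm u = norm v \<and> \<bar>inner u v\<bar> \<le> 1 / 2 * norm u * norm v"

definition good_basis :: "nat \<Rightarrow> real set \<Rightarrow> real \<Rightarrow> real \<Rightarrow> bool" where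
  "good_basis D I x y \<longleftrightarrow> Z_basis I x y \<and>
     (\<exists>\<alpha>>0. well_rounded (twist \<alpha> ` canon_emb D ` I) \<and>
        minimal_basis (twist \<alpha> ` canon_emb D ` I)
          (twist \<alpha> (canon_emb D x)) (twist \<alpha> (canon_emb D y)))"

definition basis_form :: "nat \<Rightarrow> real set \<Rightarrow> real \<Rightarrow> real \<Rightarrow> real" where
  "basis_form D I x y =
     (field_norm D x)\<^sup>2 + field_norm D x * field_norm D y + (field_norm D y)\<^sup>2
       - (real (ideal_norm D I))\<^sup>2 * field_discr D / 4"

text \<open>An unordered basis is represented by either of its orderings; this is harmless because
  \<^const>\<open>basis_form\<close> and \<^const>\<open>good_basis\<close> are symmetric.\<close>

definition basis_equiv :: "nat \<Rightarrow> real set \<Rightarrow> ((real \<times> real) \<times> (real \<times> real)) set" where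
  "basis_equiv D I = {((x, y), (x', y')). Z_basis I x y \<and> Z_basis I x' y' \<and>
     basis_form D I x y = basis_form D I x' y'}"

lemma basis_form_commute: "basis_form D I x y = basis_form D I y x"
  by (simp add: basis_form_def)

lemma Z_basis_commute: "Z_basis L u v \<longleftrightarrow> Z_basis L v u"
proof -
  have "Z_basis L b a" if "Z_basis L a b" for a b
  proof -
    have "{of_int m *\<^sub>R a + of_int n *\<^sub>R b | m n. True} =
        {of_int m *\<^sub>R b + of_int n *\<^sub>R a | m n. True}" (is "?A = ?B")
    proof
      show "?A \<subseteq> ?B" by clarify (subst add.commute, blast)
      show "?B \<subseteq> ?A" by clarify (subst add.commute, blast)
    qed
    moreover have "of_int m *\<^sub>R a + of_int n *\<^sub>R b = 0 \<Longrightarrow> m = 0 \<and> n = 0" for m n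
      using that unfolding Z_basis_def by blast
    then have "\<forall>m n. of_int m *\<^sub>R b + of_int n *\<^sub>R a = 0 \<longrightarrow> m = 0 \<and> n = 0"
      by (metis add.commute)
    ultimately show ?thesis
      using that unfolding Z_basis_def by simp
  qed
  then show ?thesis by blast
qed

lemma good_basis_commute: "good_basis D I x y \<longleftrightarrow> good_basis D I y x"
proof -
  have "minimal_basis L v u" if "minimal_basis L u v" for L u v
    using that Z_basis_commute[of L v u] inner_commute[of u v]
    unfolding minimal_basis_def by auto
  then show ?thesis
    unfolding good_basis_def using Z_basis_commute by blast
qed

lemma equiv_basis_equiv: "equiv {(x, y). Z_basis I x y} (basis_equiv D I)"
  by (auto simp: equiv_def refl_on_def sym_def trans_def basis_equiv_def)

end

theory Submission
  imports Defs
begin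

text \<open>
  For a good basis \<open>{x, y}\<close> put \<open>p = y / x\<close>, \<open>q\<close> the conjugate of \<open>p\<close>, \<open>s = (p + q) / 2\<close> and
  \<open>\<delta> = (p - q) / 2\<close>. All bases containing \<open>x\<close> arise from one of them by \<open>y \<mapsto> \<plusminus>y + kx\<close>, so up to a
  common sign \<open>s\<close> runs through a coset of the integers, while \<open>G = \<delta>\<^sup>2 - 1\<close> does not change.
  Goodness forces \<open>\<bar>s\<^sup>2 - G\<bar> \<le> \<bar>s\<bar>\<close>, and the class of the basis is determined by
  \<open>(s\<^sup>2 - G - 1/2)\<^sup>2\<close>. For \<open>s \<ge> 0\<close> the inequality confines \<open>s\<close> to an interval of length at most 1,
  so it has at most two solutions in the coset; if it has two, they are the end points
  \<open>s\<close> and \<open>s + 1\<close> with \<open>G = s\<^sup>2 + s\<close>, which give the same class. The same holds for \<open>s \<le> 0\<close>,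
  whence at most two classes.
\<close>

lemma gal_conj_lincomb:
  assumes "1 < D" "squarefree D" "x \<in> quad_field D" "y \<in> quad_field D"
  shows "gal_conj D (of_int m * x + of_int n * y) = of_int m * gal_conj D x + of_int n * gal_conj D y"
proof -
  obtain a b c d where xy: "x = a + b * sqrt (real D)" "y = c + d * sqrt (real D)"
    and rat: "a \<in> \<rat>" "b \<in> \<rat>" "c \<in> \<rat>" "d \<in> \<rat>"
    using assms unfolding quad_field_def by blast
  have lin: "of_int m * x + of_int n * y
      = (of_int m * a + of_int n * c) + (of_int m * b + of_int n * d) * sqrt (real D)"
    by (simp add: xy algebra_simps)
  have conj_lin: "gal_conj D
        ((of_int m * a + of_int n * c) + (of_int m * b + of_int n * d) * sqrt (real D))
      = (of_int m * a + of_int n * c) - (of_int m * b + of_int n * d) * sqrt (real D)"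
    using rat by (intro gal_conj_eq assms) auto
  have conj: "gal_conj D x = a - b * sqrt (real D)" "gal_conj D y = c - d * sqrt (real D)"
    unfolding xy using rat by (intro gal_conj_eq assms; simp)+
  show ?thesis unfolding lin conj_lin conj by (simp add: algebra_simps)
qed

text \<open>Otherwise \<open>sqrt (real D)\<close> would be rational. This allows division by the
  conjugate of \<open>x\<close> in forming \<open>q\<close>.\<close>

lemma gal_conj_nonzero:
  assumes "1 < D" "squarefree D" "x \<in> quad_field D" "x \<noteq> 0"
  shows "gal_conj D x \<noteq> 0"
proof
  assume "gal_conj D x = 0"
  obtain a b where x: "x = a + b * sqrt (real D)" and rat: "a \<in> \<rat>" "b \<in> \<rat>"
    using assms unfolding quad_field_def by blast
  have ab: "a = b * sqrt (real D)"
    using \<open>gal_conj D x = 0\<close> gal_conj_eq[OF assms(1,2) rat] x by simp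
  show False
  proof (cases "b = 0")
    case True
    then show ?thesis using ab x \<open>x \<noteq> 0\<close> by simp
  next
    case False
    then have "sqrt (real D) = a / b" using ab by simp
    also have "\<dots> \<in> \<rat>" using rat by simp
    finally show ?thesis using sqrt_squarefree_irrational assms by blast
  qed
qed

text \<open>Substituting each expansion into the other and comparing coefficients of
  \<open>y\<close> gives \<open>e' * e = 1\<close>, so \<open>e\<close> is a unit of the
  integers.\<close>

lemma Z_basis_exchange:
  assumes "Z_basis L x y" "Z_basis L x y'"
  obtains e k :: int where "\<bar>e\<bar> = 1" "y' = of_int k *\<^sub>R x + of_int e *\<^sub>R y"
proof -
  have mem: "v \<in> L" if "Z_basis L u v" for u v
  proof -
    have "v = of_int 0 *\<^sub>R u + of_int 1 *\<^sub>R v" by simp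
    then show ?thesis using that unfolding Z_basis_def by blast
  qed
  obtain k e where 1: "y' = of_int k *\<^sub>R x + of_int e *\<^sub>R y"
    using mem[OF assms(2)] assms(1) unfolding Z_basis_def by blast
  obtain k' e' where 2: "y = of_int k' *\<^sub>R x + of_int e' *\<^sub>R y'"
    using mem[OF assms(1)] assms(2) unfolding Z_basis_def by blast
  have "of_int (k' + e' * k) *\<^sub>R x + of_int (e' * e - 1) *\<^sub>R y
      = (of_int k' *\<^sub>R x + of_int e' *\<^sub>R (of_int k *\<^sub>R x + of_int e *\<^sub>R y)) - y"
    by (simp add: algebra_simps)
  also have "\<dots> = 0" by (simp only: 1[symmetric] 2[symmetric] diff_self)
  finally have "e' * e - 1 = 0" using assms(1) unfolding Z_basis_def by blast
  then have "\<bar>e\<bar> = 1" by (auto simp: zmult_eq_1_iff)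
  then show ?thesis using that 1 by blast
qed

text \<open>The twisting parameter is eliminated: equality of norms expresses
  \<open>p * q + 1\<close> through the inner product, which minimality bounds.\<close>

lemma good_basis_ratio_bound:
  assumes "good_basis D I x y" "x \<noteq> 0" "gal_conj D x \<noteq> 0"
  defines "p \<equiv> y / x" and "q \<equiv> gal_conj D y / gal_conj D x"
  shows "\<bar>p * q + 1\<bar> \<le> \<bar>p + q\<bar> / 2"
proof -
  let ?x' = "gal_conj D x"
  obtain \<alpha> where \<alpha>: "\<alpha> > 0"
    and min: "norm (twist \<alpha> (canon_emb D x)) = norm (twist \<alpha> (canon_emb D y))"
      "\<bar>inner (twist \<alpha> (canon_emb D x)) (twist \<alpha> (canon_emb D y))\<bar>
        \<le> 1 / 2 * norm (twist \<alpha> (canon_emb D x)) * norm (twist \<alpha> (canon_emb D y))"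
    using assms(1) unfolding good_basis_def minimal_basis_def by blast
  \<comment> \<open>Squared coordinates of the twisted \<open>x\<close>; those of the twisted
    \<open>y\<close> are \<open>A * p^2\<close> and \<open>B * q^2\<close>.\<close>
  define A B where "A = (\<alpha> * x)\<^sup>2" and "B = (?x' / \<alpha>)\<^sup>2"
  have pos: "A + B > 0" using \<alpha> assms(2) unfolding A_def B_def by (simp add: add_pos_nonneg)
  have emb: "canon_emb D x = (x, ?x')" "canon_emb D y = (p * x, q * ?x')"
    using assms by (simp_all add: canon_emb_def)
  have nx: "(norm (twist \<alpha> (canon_emb D x)))\<^sup>2 = A + B"
    unfolding power2_norm_eq_inner
    by (simp add: twist_def emb inner_prod_def A_def B_def power2_eq_square)
  have "(norm (twist \<alpha> (canon_emb D y)))\<^sup>2 = A * p\<^sup>2 + B * q\<^sup>2"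
    unfolding power2_norm_eq_inner
    by (simp add: twist_def emb inner_prod_def A_def B_def power2_eq_square)
  then have eq: "A * p\<^sup>2 + B * q\<^sup>2 = A + B" using min nx by simp
  have "inner (twist \<alpha> (canon_emb D x)) (twist \<alpha> (canon_emb D y)) = A * p + B * q"
    by (simp add: twist_def emb inner_prod_def A_def B_def power2_eq_square)
  then have bd: "\<bar>A * p + B * q\<bar> \<le> (A + B) / 2"
    using min nx by (simp add: power2_eq_square)
  \<comment> \<open>The right side expands to \<open>A * p^2 + B * q^2 + (A + B) * p * q\<close>,
    whose first two terms sum to \<open>A + B\<close> by \<open>eq\<close>.\<close>
  have fac: "(A + B) * (p * q + 1) = (A * p + B * q) * (p + q)"
    using eq by (simp add: algebra_simps power2_eq_square)
  have "(A + B) * \<bar>p * q + 1\<bar> = \<bar>A * p + B * q\<bar> * \<bar>p + q\<bar>"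
    using pos unfolding abs_mult[symmetric] fac[symmetric] by (simp add: abs_mult)
  also have "\<dots> \<le> (A + B) / 2 * \<bar>p + q\<bar>" using bd by (rule mult_right_mono) simp
  finally have "(A + B) * \<bar>p * q + 1\<bar> \<le> (A + B) * (\<bar>p + q\<bar> / 2)" by simp
  then show ?thesis using pos by (simp only: mult_le_cancel_left_pos)
qed

lemma nonneg_coset_unique_value:
  fixes s t G :: real
  assumes "t - s \<in> \<int>" "0 \<le> s" "0 \<le> t" "\<bar>s\<^sup>2 - G\<bar> \<le> s" "\<bar>t\<^sup>2 - G\<bar> \<le> t"
  shows "(s\<^sup>2 - G - 1/2)\<^sup>2 = (t\<^sup>2 - G - 1/2)\<^sup>2"
  using assms
proof (induction s t rule: linorder_wlog)
  case (le s t)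
  obtain j where j: "t - s = of_int j" using le.prems(1) by (elim Ints_cases)
  then have t: "t = s + of_int j" by simp
  have "j \<ge> 0" using j \<open>s \<le> t\<close> by linarith
  have "t\<^sup>2 - t \<le> s\<^sup>2 + s" using le.prems by linarith
  \<comment> \<open>The left side is \<open>(t + s) * (t - s - 1)\<close> written in terms of
    \<open>j = t - s\<close>.\<close>
  then have *: "2 * ((of_int j - 1) * s) + of_int j * (of_int j - 1) \<le> 0"
    by (simp add: t power2_eq_square algebra_simps)
  have "j \<le> 1"
  proof (rule ccontr)
    assume "\<not> j \<le> 1"
    then have "(of_int j - 1) * s \<ge> 0" "of_int j * (of_int j - 1 :: real) > 0"
      using le.prems by simp_all
    with * show False by linarith
  qed
  with \<open>j \<ge> 0\<close> consider "j = 0" | "j = 1" by linarith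
  then show ?case
  proof cases
    case 2
    then have t: "t = s + 1" using t by simp
    \<comment> \<open>The upper bound on \<open>G\<close> from \<open>s\<close> and the lower bound
      from \<open>t\<close> coincide here. The two numbers squared in the goal are then
      \<open>-(s + 1/2)\<close> and \<open>s + 1/2\<close>.\<close>
    have "G = s\<^sup>2 + s" using le.prems by (simp add: t power2_eq_square algebra_simps)
    then show ?thesis by (simp add: t power2_eq_square algebra_simps)
  qed (simp add: t)
next
  case (sym s t)
  have "s - t \<in> \<int>" using Ints_minus[OF sym.prems(1)] by simp
  then show ?case using sym by simp
qed

lemma coset_two_values:
  fixes s G :: real
  defines "T \<equiv> {t. t - s \<in> \<int> \<and> \<bar>t\<^sup>2 - G\<bar> \<le> \<bar>t\<bar>}"
  shows "\<exists>v w. (\<lambda>t. (t\<^sup>2 - G - 1/2)\<^sup>2) ` T \<subseteq> {v, w}"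
proof -
  let ?h = "\<lambda>t::real. (t\<^sup>2 - G - 1/2)\<^sup>2"
  have diff: "t - u \<in> \<int>" if "t \<in> T" "u \<in> T" for t u
    using Ints_diff[of "t - s" "u - s"] that unfolding T_def by simp
  have bound: "\<bar>t\<^sup>2 - G\<bar> \<le> \<bar>t\<bar>" if "t \<in> T" for t
    using that unfolding T_def by simp
  have pos: "?h t = ?h u" if "t \<in> T" "u \<in> T" "0 \<le> t" "0 \<le> u" for t u
    using nonneg_coset_unique_value[OF diff[OF that(2,1)] that(3,4), of G] that(3,4)
      bound[OF that(1)] bound[OF that(2)] by simp
  \<comment> \<open>Negation reduces this to the nonnegative case. The negated coset may be a
    different one, but only integrality of differences matters.\<close>
  have neg: "?h t = ?h u" if "t \<in> T" "u \<in> T" "t \<le> 0" "u \<le> 0" for t u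
    using nonneg_coset_unique_value[of "- u" "- t" G] diff[OF that(1,2)] that(3,4)
      bound[OF that(1)] bound[OF that(2)] by simp
  obtain v where v: "\<forall>t\<in>T. 0 \<le> t \<longrightarrow> ?h t = v" using pos by metis
  obtain w where w: "\<forall>t\<in>T. t \<le> 0 \<longrightarrow> ?h t = w" using neg by metis
  have "?h t \<in> {v, w}" if "t \<in> T" for t
    using v w that linear[of 0 t] by blast
  then have "?h ` T \<subseteq> {v, w}" by (rule image_subsetI)
  then show ?thesis by blast
qed

lemma basis_form_two_values:
  assumes D: "1 < D" "squarefree D" and I: "I \<subseteq> quad_field D"
  shows "\<exists>v w. basis_form D I x ` {y \<in> I. good_basis D I x y} \<subseteq> {v, w}"
proof (cases "\<exists>y\<in>I. good_basis D I x y")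
  case False
  then show ?thesis by auto
next
  case True
  then obtain y0 where y0: "y0 \<in> I" "good_basis D I x y0" by blast
  have basis: "Z_basis I x y" if "good_basis D I x y" for y
    using that unfolding good_basis_def by blast
  have "x = of_int 1 *\<^sub>R x + of_int 0 *\<^sub>R y0" by simp
  then have xI: "x \<in> I" using basis[OF y0(2)] unfolding Z_basis_def by blast
  have "x \<noteq> 0"
  proof
    assume "x = 0"
    then have "of_int 1 *\<^sub>R x + of_int 0 *\<^sub>R y0 = 0" by simp
    then have "(1::int) = 0" using basis[OF y0(2)] unfolding Z_basis_def by blast
    then show False by simp
  qed
  let ?x' = "gal_conj D x"
  have x'0: "?x' \<noteq> 0" using gal_conj_nonzero D I xI \<open>x \<noteq> 0\<close> by blast
  define p q where "p = (\<lambda>y. y / x)" and "q = (\<lambda>y. gal_conj D y / ?x')"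
  define s where "s = (\<lambda>y. (p y + q y) / 2)"
  define G where "G = ((p y0 - q y0) / 2)\<^sup>2 - 1"
  define h where "h = (\<lambda>t. (t\<^sup>2 - G - 1/2)\<^sup>2)"
  define n where "n = field_norm D x"
  \<comment> \<open>With \<open>r = p y * q y\<close>, completing the square in
    \<open>1 + r + r^2 = (r + 1/2)^2 + 3/4\<close> leaves the term \<open>3/4\<close> here.\<close>
  define C where "C = 3/4 * n\<^sup>2 - (real (ideal_norm D I))\<^sup>2 * field_discr D / 4"
  obtain v w where vw: "h ` {t. t - s y0 \<in> \<int> \<and> \<bar>t\<^sup>2 - G\<bar> \<le> \<bar>t\<bar>} \<subseteq> {v, w}"
    using coset_two_values unfolding h_def by blast
  have "basis_form D I x y \<in> {n\<^sup>2 * v + C, n\<^sup>2 * w + C}" if y: "good_basis D I x y" for y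
  proof -
    obtain e k where e: "\<bar>e\<bar> = 1" and "y = of_int k *\<^sub>R x + of_int e *\<^sub>R y0"
      using Z_basis_exchange basis y y0 by metis
    then have yk: "y = of_int k * x + of_int e * y0" by simp
    have "gal_conj D y = of_int k * ?x' + of_int e * gal_conj D y0"
      unfolding yk using gal_conj_lincomb D I xI y0 by blast
    then have pq: "p y = of_int k + of_int e * p y0" "q y = of_int k + of_int e * q y0"
      using \<open>x \<noteq> 0\<close> x'0 yk by (simp_all add: p_def q_def field_simps)
    have e2: "(of_int e :: real) * of_int e = 1"
      using e by (auto simp: abs_if split: if_splits)
    \<comment> \<open>Passing from \<open>y0\<close> to \<open>y\<close> only multiplies
      \<open>p - q\<close> by the sign \<open>e\<close>, so \<open>G\<close> can be computed from
      \<open>y\<close> as well.\<close>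
    have sG: "(s y)\<^sup>2 - G = p y * q y + 1"
    proof -
      have "((p y - q y) / 2)\<^sup>2 = (of_int e * of_int e) * ((p y0 - q y0) / 2)\<^sup>2"
        by (simp add: pq power2_eq_square algebra_simps)
      then have "G = ((p y - q y) / 2)\<^sup>2 - 1" by (simp add: G_def e2)
      then show ?thesis by (simp add: s_def power2_eq_square field_simps)
    qed
    \<comment> \<open>The factor \<open>e\<close> undoes the sign in the change of basis, bringing
      \<open>s y\<close> into the coset of \<open>s y0\<close>; the bound and \<open>h\<close> see
      only its absolute value.\<close>
    define t where "t = of_int e * s y"
    have t2: "t\<^sup>2 = (s y)\<^sup>2" "\<bar>t\<bar> = \<bar>s y\<bar>"
      using e by (auto simp: t_def abs_if split: if_splits)
    have "t = (of_int e * of_int e) * s y0 + of_int (e * k)"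
      by (simp add: t_def s_def pq algebra_simps add_divide_distrib)
    then have "t - s y0 \<in> \<int>" by (simp add: e2)
    moreover have "\<bar>t\<^sup>2 - G\<bar> \<le> \<bar>t\<bar>"
      using good_basis_ratio_bound[OF y \<open>x \<noteq> 0\<close> x'0] sG t2
      by (simp add: p_def q_def s_def)
    ultimately have "h t \<in> {v, w}" using vw by blast
    moreover have "basis_form D I x y = n\<^sup>2 * h t + C"
    proof -
      have "field_norm D y = n * (p y * q y)"
        using \<open>x \<noteq> 0\<close> x'0 by (simp add: field_norm_def n_def p_def q_def)
      moreover have "h t = (p y * q y + 1/2)\<^sup>2" using t2 sG by (simp add: h_def add.commute)
      ultimately show ?thesis
        unfolding basis_form_def n_def[symmetric] C_def
        by (simp add: power2_eq_square algebra_simps)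
    qed
    ultimately show ?thesis by auto
  qed
  then show ?thesis by blast
qed

theorem theorem4p1:
  fixes D :: nat and I :: "real set" and x :: real
  assumes "1 < D" and "squarefree D"
    and "ideal I (alg_int_ring D)" and "I \<noteq> {0}"
    and "x \<in> I"
    and "(field_norm D x)\<^sup>2 \<le> (real (ideal_norm D I))\<^sup>2 * field_discr D / 3"
  shows "finite ({(x, y) | y. y \<in> I \<and> good_basis D I x y} // basis_equiv D I) \<and>
    card ({(x, y) | y. y \<in> I \<and> good_basis D I x y} // basis_equiv D I) \<le> 2"
proof -
  let ?S = "{(x, y) | y. y \<in> I \<and> good_basis D I x y}"
  have "I \<subseteq> quad_field D"
    using ideal.Icarr[OF assms(3)] by (auto simp: alg_int_ring_def)
  then obtain v w where vw: "basis_form D I x ` {y \<in> I. good_basis D I x y} \<subseteq> {v, w}"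
    using basis_form_two_values assms by metis
  \<comment> \<open>Each class is the fibre of \<open>basis_form\<close> over its value, so counting
    classes reduces to counting values.\<close>
  define \<Phi> where "\<Phi> = (\<lambda>c. {(x', y'). Z_basis I x' y' \<and> c = basis_form D I x' y'})"
  have "basis_equiv D I `` {(x, y)} = \<Phi> (basis_form D I x y)" if "good_basis D I x y" for y
    using that unfolding basis_equiv_def \<Phi>_def good_basis_def by auto
  then have "?S // basis_equiv D I = \<Phi> ` basis_form D I x ` {y \<in> I. good_basis D I x y}"
    unfolding quotient_def by auto
  with image_mono[OF vw] have sub: "?S // basis_equiv D I \<subseteq> \<Phi> ` {v, w}" by simp
  moreover have "card (\<Phi> ` {v, w}) \<le> 2"
    using card_image_le[of "{v, w}" \<Phi>] card_insert_le_m1[of 2 "{w}" v] by simp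
  ultimately show ?thesis
    using finite_subset[OF sub] card_mono[OF _ sub] by simp
qed

end
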